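(* Let $(L,[\,,\,]_L,\alpha)$ and $(\Gamma,[\,,\,]_\Gamma,\beta)$ be multiplicative Hom-Lie superalgebras over $F$, and let $\varphi:L\to\Gamma$ be a one-to-one morphism of Hom-Lie superalgebras. If $C$ is a Hom-Lie subsuperalgebra of $\Gamma$ and $[p]:C^0\to C^0$ is a $p$-map, then $(\varphi^{-1}(C),[\,,\,]_L,\alpha|_{\varphi^{-1}(C)},[p]')$, where $$[p]':(\varphi^{-1}(C))^0\to(\varphi^{-1}(C))^0,\qquad x\mapsto\varphi^{-1}\big((\varphi(x))^{[p]}\big),$$ is a restricted Hom-Lie superalgebra.
   Context: $F$ is a field of characteristic $p>0$ with $p\neq 2,3$. A linear superspace is a $\mathbb{Z}_2$-graded $F$-vector space $V=V_0\oplus V_1$; $|x|$ denotes the parity of a homogeneous element $x$; a linear map $V\to V'$ is even if it maps $V_j$ into $V'_j$ for $j=0,1$, and a bilinear map is even if it respects the grading. A Hom-Lie superalgebra is a triple $(L,[\,,\,],\alpha)$ with $L$ a linear superspace, $[\,,\,]:L\times L\to L$ an even bilinear map and $\alpha:L\to L$ an even linear map such that for all homogeneous $x,y,z$: $[x,y]=-(-1)^{|x||y|}[y,x]$ and $(-1)^{|x||z|}[\alpha(x),[y,z]]+(-1)^{|z||y|}[\alpha(z),[x,y]]+(-1)^{|y||x|}[\alpha(y),[z,x]]=0$. It is multiplicative if $\alpha([x,y])=[\alpha(x),\alpha(y)]$ for all $x,y$. A Hom-Lie subsuperalgebra is a (graded) subspace $H=H_0\oplus H_1$, $H_j=H\cap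 L_j$, with $\alpha(H)\subseteq H$ and $[x,y]\in H$ for all $x,y\in H$. A morphism of Hom-Lie superalgebras $\varphi:(L,[\,,\,]_L,\alpha)\to(\Gamma,[\,,\,]_\Gamma,\beta)$ is an even linear map with $\varphi([u,v]_L)=[\varphi(u),\varphi(v)]_\Gamma$ for all $u,v\in L$ and $\varphi\circ\alpha=\beta\circ\varphi$. For a multiplicative Hom-Lie superalgebra $L$ put $L^0=\{x\in L_0:\alpha(x)=x\}$ (and likewise for subsuperalgebras), and for $a\in L^0$ let $\mathrm{ad}_\alpha a:L\to L$, $b\mapsto[a,\alpha(b)]$. A $p$-map for $L$ is a map $[p]:L^0\to L^0$, $x\mapsto x^{[p]}$, such that (1) $(\mathrm{ad}_\alpha x)^p=\mathrm{ad}_\alpha(x^{[p]})$ on $L$ for all $x\in L^0$; (2) $(kx)^{[p]}=k^px^{[p]}$ for all $k\in F$, $x\in L^0$; (3) $(x+y)^{[p]}=x^{[p]}+y^{[p]}+\sum_{i=1}^{p-1}s_i(x,y)$ for all $x,y\in L^0$, where $i\,s_i(x,y)$ is the coefficient of $\lambda^{i-1}$ in $(\mathrm{ad}_\alpha(\lambda x+y))^{p-1}(x)$. A restricted Hom-Lie superalgebra $(L,[\,,\,],\alpha,[p])$ is a multiplicative Hom-Lie superalgebra together with a $p$-map.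
   Formalization: "One-to-one" is read as injective, and it is additionally assumed that φ(x)^{[p]} lies in φ(L) for every x in (φ^{-1}(C))^0, since otherwise φ^{-1}((φ(x))^{[p]}) can be undefined. *)

theory Defs
  imports
    "HOL-Computational_Algebra.Computational_Algebra"
    "HOL-Library.Z2"
    "HOL-Library.FuncSet"
begin

text \<open>
  Superspaces are carrier sets V inside an ambient vector space, graded by the field \<open>bit\<close> with
  two elements. Brackets and twisting maps are functions on the ambient type of which only the
  values on the carrier are constrained.
\<close>

locale superspace = vector_space scale
  for scale :: "'f::field \<Rightarrow> 'v::ab_group_add \<Rightarrow> 'v" +
  fixes V :: "'v set" and G :: "bit \<Rightarrow> 'v set"
  assumes subspace_carrier: "subspace V"
    and subspace_component: "\<And>i. subspace (G i)"
    and sum_components: "V = {x + y | x y. x \<in> G 0 \<and> y \<in> G 1}"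
    and Int_components: "G 0 \<inter> G 1 = {0}"

definition linear_on ::
  "('f::field \<Rightarrow> 'v::ab_group_add \<Rightarrow> 'v) \<Rightarrow> ('f \<Rightarrow> 'w::ab_group_add \<Rightarrow> 'w)
    \<Rightarrow> 'v set \<Rightarrow> 'w set \<Rightarrow> ('v \<Rightarrow> 'w) \<Rightarrow> bool"
  where "linear_on s t V W f \<longleftrightarrow>
    f \<in> V \<rightarrow> W \<and>
    (\<forall>x\<in>V. \<forall>y\<in>V. f (x + y) = f x + f y) \<and>
    (\<forall>c. \<forall>x\<in>V. f (s c x) = t c (f x))"

definition even_on :: "(bit \<Rightarrow> 'v set) \<Rightarrow> (bit \<Rightarrow> 'w set) \<Rightarrow> ('v \<Rightarrow> 'w) \<Rightarrow> bool"
  where "even_on G H f \<longleftrightarrow> (\<forall>i. f \<in> G i \<rightarrow> H i)"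

text \<open>The sign \<open>(- 1)\<close> to the power \<open>i * j\<close>, for parities i and j.\<close>

definition parity_sign :: "bit \<Rightarrow> bit \<Rightarrow> 'f::field"
  where "parity_sign i j = (if i * j = 1 then - 1 else 1)"

locale hom_lie_superalgebra = superspace scale L G
  for scale :: "'f::field \<Rightarrow> 'v::ab_group_add \<Rightarrow> 'v"
    and L :: "'v set" and G :: "bit \<Rightarrow> 'v set" +
  fixes br :: "'v \<Rightarrow> 'v \<Rightarrow> 'v" and \<alpha> :: "'v \<Rightarrow> 'v"
  assumes br_linear_right: "\<And>x. x \<in> L \<Longrightarrow> linear_on scale scale L L (\<lambda>y. br x y)"
    and br_linear_left: "\<And>y. y \<in> L \<Longrightarrow> linear_on scale scale L L (\<lambda>x. br x y)"
    and br_even: "\<And>i j x y. x \<in> G i \<Longrightarrow> y \<in> G j \<Longrightarrow> br x y \<in> G (i + j)"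
    and \<alpha>_linear: "linear_on scale scale L L \<alpha>"
    and \<alpha>_even: "even_on G G \<alpha>"
    and skew_supersymmetry: "\<And>i j x y. x \<in> G i \<Longrightarrow> y \<in> G j \<Longrightarrow>
      br x y = - scale (parity_sign i j) (br y x)"
    and hom_jacobi: "\<And>i j k x y z. x \<in> G i \<Longrightarrow> y \<in> G j \<Longrightarrow> z \<in> G k \<Longrightarrow>
      scale (parity_sign i k) (br (\<alpha> x) (br y z))
      + scale (parity_sign k j) (br (\<alpha> z) (br x y))
      + scale (parity_sign j i) (br (\<alpha> y) (br z x)) = 0"

locale multiplicative_hom_lie_superalgebra = hom_lie_superalgebra +
  assumes multiplicative: "\<And>x y. x \<in> L \<Longrightarrow> y \<in> L \<Longrightarrow> \<alpha> (br x y) = br (\<alpha> x) (\<alpha> y)"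

locale hom_lie_subsuperalgebra =
  hom_lie_superalgebra scale L G br \<alpha> + sub: superspace scale H "\<lambda>j. H \<inter> G j"
  for scale :: "'f::field \<Rightarrow> 'v::ab_group_add \<Rightarrow> 'v"
    and L :: "'v set" and G :: "bit \<Rightarrow> 'v set"
    and br :: "'v \<Rightarrow> 'v \<Rightarrow> 'v" and \<alpha> :: "'v \<Rightarrow> 'v" and H :: "'v set" +
  assumes sub_subset: "H \<subseteq> L"
    and sub_\<alpha>: "\<alpha> ` H \<subseteq> H"
    and sub_br: "\<And>x y. x \<in> H \<Longrightarrow> y \<in> H \<Longrightarrow> br x y \<in> H"

locale hom_lie_morphism =
  dom: hom_lie_superalgebra s L G br \<alpha> + cod: hom_lie_superalgebra t M K br' \<beta>
  for s :: "'f::field \<Rightarrow> 'v::ab_group_add \<Rightarrow> 'v"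
    and L :: "'v set" and G :: "bit \<Rightarrow> 'v set"
    and br :: "'v \<Rightarrow> 'v \<Rightarrow> 'v" and \<alpha> :: "'v \<Rightarrow> 'v"
    and t :: "'f \<Rightarrow> 'w::ab_group_add \<Rightarrow> 'w"
    and M :: "'w set" and K :: "bit \<Rightarrow> 'w set"
    and br' :: "'w \<Rightarrow> 'w \<Rightarrow> 'w" and \<beta> :: "'w \<Rightarrow> 'w" +
  fixes \<phi> :: "'v \<Rightarrow> 'w"
  assumes \<phi>_linear: "linear_on s t L M \<phi>"
    and \<phi>_even: "even_on G K \<phi>"
    and \<phi>_br: "\<And>u v. u \<in> L \<Longrightarrow> v \<in> L \<Longrightarrow> \<phi> (br u v) = br' (\<phi> u) (\<phi> v)"
    and \<phi>_twist: "\<And>u. u \<in> L \<Longrightarrow> \<phi> (\<alpha> u) = \<beta> (\<phi> u)"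

definition even_fixed :: "(bit \<Rightarrow> 'v set) \<Rightarrow> ('v \<Rightarrow> 'v) \<Rightarrow> 'v set"
  where "even_fixed G \<alpha> = {x \<in> G 0. \<alpha> x = x}"

definition hom_ad :: "('v \<Rightarrow> 'v \<Rightarrow> 'v) \<Rightarrow> ('v \<Rightarrow> 'v) \<Rightarrow> 'v \<Rightarrow> 'v \<Rightarrow> 'v"
  where "hom_ad br \<alpha> a b = br a (\<alpha> b)"

text \<open>
  Polynomials in an indeterminate \<open>\<lambda>\<close> with coefficients in L have type \<open>'v poly\<close>; this is the
  bracket extended bilinearly over \<open>\<lambda>\<close>. The twisting map extends coefficientwise, by \<open>map_poly\<close>.
\<close>

definition poly_bracket ::
  "('v::ab_group_add \<Rightarrow> 'v \<Rightarrow> 'v) \<Rightarrow> 'v poly \<Rightarrow> 'v poly \<Rightarrow> 'v poly"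
  where "poly_bracket br P Q =
    (\<Sum>i\<le>degree P. \<Sum>j\<le>degree Q. monom (br (coeff P i) (coeff Q j)) (i + j))"

text \<open>
  \<open>s_term scale br \<alpha> i x y\<close> is \<open>s\<^sub>i(x, y)\<close>; \<open>[:y, x:]\<close> is \<open>\<lambda>x + y\<close>. For \<open>1 \<le> i \<le> p - 1\<close> the
  scalar i is invertible, so \<open>s\<^sub>i(x, y)\<close> is determined by \<open>i s\<^sub>i(x, y)\<close>.
\<close>

definition s_term ::
  "('f::field \<Rightarrow> 'v::ab_group_add \<Rightarrow> 'v) \<Rightarrow> ('v \<Rightarrow> 'v \<Rightarrow> 'v) \<Rightarrow> ('v \<Rightarrow> 'v)
    \<Rightarrow> nat \<Rightarrow> 'v \<Rightarrow> 'v \<Rightarrow> 'v"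
  where "s_term scale br \<alpha> i x y =
    scale (inverse (of_nat i))
      (coeff ((hom_ad (poly_bracket br) (map_poly \<alpha>) [:y, x:] ^^ (CHAR('f) - 1)) [:x:]) (i - 1))"

definition p_map ::
  "('f::field \<Rightarrow> 'v::ab_group_add \<Rightarrow> 'v) \<Rightarrow> 'v set \<Rightarrow> (bit \<Rightarrow> 'v set)
    \<Rightarrow> ('v \<Rightarrow> 'v \<Rightarrow> 'v) \<Rightarrow> ('v \<Rightarrow> 'v) \<Rightarrow> ('v \<Rightarrow> 'v) \<Rightarrow> bool"
  where "p_map scale L G br \<alpha> pm \<longleftrightarrow>
    pm \<in> even_fixed G \<alpha> \<rightarrow> even_fixed G \<alpha> \<and>
    (\<forall>x \<in> even_fixed G \<alpha>. \<forall>b \<in> L.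
      (hom_ad br \<alpha> x ^^ CHAR('f)) b = hom_ad br \<alpha> (pm x) b) \<and>
    (\<forall>k. \<forall>x \<in> even_fixed G \<alpha>. pm (scale k x) = scale (k ^ CHAR('f)) (pm x)) \<and>
    (\<forall>x \<in> even_fixed G \<alpha>. \<forall>y \<in> even_fixed G \<alpha>.
      pm (x + y) = pm x + pm y + (\<Sum>i = 1..CHAR('f) - 1. s_term scale br \<alpha> i x y))"

locale restricted_hom_lie_superalgebra =
  multiplicative_hom_lie_superalgebra scale L G br \<alpha>
  for scale :: "'f::field \<Rightarrow> 'v::ab_group_add \<Rightarrow> 'v"
    and L :: "'v set" and G :: "bit \<Rightarrow> 'v set"
    and br :: "'v \<Rightarrow> 'v \<Rightarrow> 'v" and \<alpha> :: "'v \<Rightarrow> 'v" +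
  fixes pm :: "'v \<Rightarrow> 'v"
  assumes p_map: "p_map scale L G br \<alpha> pm"

text \<open>The preimage of C under a map with domain L.\<close>

definition preimage_on :: "'v set \<Rightarrow> ('v \<Rightarrow> 'w) \<Rightarrow> 'w set \<Rightarrow> 'v set"
  where "preimage_on L \<phi> C = {x \<in> L. \<phi> x \<in> C}"

end

(* Restricting an injective morphism to the preimage D of C gives an injective morphism from D to C.
   It intertwines the operators ad x and ad (phi x), also after extension of scalars to polynomials
   in lambda, hence it carries s_i(x, y) to s_i(phi x, phi y). Every axiom of a p-map on D becomes,
   after applying phi, the corresponding axiom on C, and injectivity cancels phi. *)

theory Submission
  imports Defs
begin

section \<open>Linear maps on subspaces, and decompositions into graded components\<close>

lemma linear_on_restrict:
  assumes "linear_on s t V W f" "A \<subseteq> V" "module.subspace s A" "module s" "f ` A \<subseteq> B"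
    and "\<And>x. x \<in> A \<Longrightarrow> g x = f x"
  shows "linear_on s t A B g"
proof -
  interpret module s by fact
  show ?thesis
    using assms(1,2,5,6) subspace_add[OF assms(3)] subspace_scale[OF assms(3)]
    unfolding linear_on_def by (auto simp: subset_iff image_subset_iff)
qed

context superspace
begin

lemma component_subset: "G i \<subseteq> V"
proof
  fix x assume x: "x \<in> G i"
  \<comment> \<open>An element of one component decomposes with 0 as its other part.\<close>
  have zero: "0 \<in> G j" for j by (rule subspace_0[OF subspace_component])
  show "x \<in> V"
  proof (cases i)
    case zero
    then show ?thesis unfolding sum_components using x \<open>0 \<in> G 1\<close> by force
  next
    case one
    then show ?thesis unfolding sum_components using x \<open>0 \<in> G 0\<close> by force
  qed
qed

text \<open>The difference of two decompositions is both even and odd, hence lies in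
  \<open>G 0 \<inter> G 1\<close>, which is zero.\<close>

lemma components_unique:
  assumes "x \<in> G 0" "x' \<in> G 0" "y \<in> G 1" "y' \<in> G 1" "x + y = x' + y'"
  shows "x = x' \<and> y = y'"
proof -
  have eq: "x - x' = y' - y"
    using assms(5) by (simp add: algebra_simps)
  have "x - x' \<in> G 0" "y' - y \<in> G 1"
    using assms(1-4) subspace_diff[OF subspace_component] by auto
  then have "x - x' \<in> G 0 \<inter> G 1" by (simp add: eq)
  then have "x - x' = 0" by (simp only: Int_components singleton_iff)
  then show ?thesis using assms(5) by simp
qed

end

section \<open>Closure of the carrier, and subsuperalgebras as superalgebras\<close>

context hom_lie_superalgebra
begin

lemma zero_mem: "0 \<in> L"
  by (rule subspace_0[OF subspace_carrier])

lemma br_mem: "x \<in> L \<Longrightarrow> y \<in> L \<Longrightarrow> br x y \<in> L"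
  using br_linear_right unfolding linear_on_def by blast

lemma twist_mem: "x \<in> L \<Longrightarrow> \<alpha> x \<in> L"
  using \<alpha>_linear unfolding linear_on_def by blast

text \<open>Lets \<open>coeff_map_poly\<close> be applied to \<open>\<alpha>\<close>:
  \<open>map_poly\<close> acts coefficientwise only for functions that send 0 to 0.\<close>

lemma twist_zero: "\<alpha> 0 = 0"
proof -
  have "\<alpha> (scale 0 0) = scale 0 (\<alpha> 0)"
    using \<alpha>_linear zero_mem unfolding linear_on_def by blast
  then show ?thesis by simp
qed

lemma hom_ad_mem: "a \<in> L \<Longrightarrow> b \<in> L \<Longrightarrow> hom_ad br \<alpha> a b \<in> L"
  unfolding hom_ad_def by (intro br_mem twist_mem)

text \<open>The bracket is controlled only on \<open>L\<close>, so iterating its polynomial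
  extension requires all coefficients to stay there. They do, being finite sums of brackets of
  elements of \<open>L\<close>.\<close>

lemma coeff_poly_bracket_mem:
  assumes "\<And>n. coeff P n \<in> L" "\<And>n. coeff Q n \<in> L"
  shows "coeff (poly_bracket br P Q) n \<in> L"
  unfolding poly_bracket_def
  by (auto simp: coeff_sum zero_mem intro!: subspace_sum[OF subspace_carrier] br_mem assms)

end

text \<open>All identities of \<open>L\<close> are inherited: \<open>restrict \<alpha> H\<close>
  agrees with \<open>\<alpha>\<close> on \<open>H\<close>, and every argument at which an axiom
  evaluates the twist lies in \<open>H\<close>.\<close>

lemma multiplicative_hom_lie_superalgebra_sub:
  assumes "multiplicative_hom_lie_superalgebra scale L G br \<alpha>"
    and "hom_lie_subsuperalgebra scale L G br \<alpha> H"
  shows "multiplicative_hom_lie_superalgebra scale H (\<lambda>j. H \<inter> G j) br (restrict \<alpha> H)"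
proof -
  interpret multiplicative_hom_lie_superalgebra scale L G br \<alpha> by fact
  interpret S: hom_lie_subsuperalgebra scale L G br \<alpha> H by fact
  note sub = S.sub_subset and mem = S.sub_\<alpha> S.sub_br
  show ?thesis
  proof unfold_locales
    fix x assume x: "x \<in> H"
    show "linear_on scale scale H H (br x)"
      by (rule linear_on_restrict[OF br_linear_right sub S.sub.subspace_carrier module_axioms])
        (use x sub mem in auto)
    show "linear_on scale scale H H (\<lambda>y. br y x)"
      by (rule linear_on_restrict[OF br_linear_left sub S.sub.subspace_carrier module_axioms])
        (use x sub mem in auto)
  next
    show "linear_on scale scale H H (restrict \<alpha> H)"
      by (rule linear_on_restrict[OF \<alpha>_linear sub S.sub.subspace_carrier module_axioms])
        (use mem in auto)
    show "even_on (\<lambda>j. H \<inter> G j) (\<lambda>j. H \<inter> G j) (restrict \<alpha> H)"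
      using \<alpha>_even mem unfolding even_on_def by (auto simp: Pi_iff)
  next
    fix x y assume "x \<in> H" "y \<in> H"
    \<comment> \<open>Membership of \<open>br x y\<close> in \<open>H\<close> is what removes
      \<open>restrict\<close> on the left-hand side.\<close>
    moreover from this have "br x y \<in> H" "x \<in> L" "y \<in> L" using sub mem by auto
    ultimately show "restrict \<alpha> H (br x y) = br (restrict \<alpha> H x) (restrict \<alpha> H y)"
      by (simp add: multiplicative)
  next
    fix i j x y assume "x \<in> H \<inter> G i" "y \<in> H \<inter> G j"
    then have *: "x \<in> H" "y \<in> H" "x \<in> G i" "y \<in> G j" by simp_all
    show "br x y \<in> H \<inter> G (i + j)"
      using S.sub_br[OF *(1,2)] br_even[OF *(3,4)] by simp
    show "br x y = - scale (parity_sign i j) (br y x)"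
      by (rule skew_supersymmetry[OF *(3,4)])
  next
    fix i j k x y z assume "x \<in> H \<inter> G i" "y \<in> H \<inter> G j" "z \<in> H \<inter> G k"
    then show "scale (parity_sign i k) (br (restrict \<alpha> H x) (br y z))
        + scale (parity_sign k j) (br (restrict \<alpha> H z) (br x y))
        + scale (parity_sign j i) (br (restrict \<alpha> H y) (br z x)) = 0"
      using hom_jacobi by simp
  qed
qed

section \<open>Morphisms, preimages of subsuperalgebras, restriction of morphisms\<close>

context hom_lie_morphism
begin

lemma map_mem: "x \<in> L \<Longrightarrow> \<phi> x \<in> M"
  using \<phi>_linear unfolding linear_on_def by blast

lemma map_add: "x \<in> L \<Longrightarrow> y \<in> L \<Longrightarrow> \<phi> (x + y) = \<phi> x + \<phi> y"
  using \<phi>_linear unfolding linear_on_def by blast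

lemma map_scale: "x \<in> L \<Longrightarrow> \<phi> (s c x) = t c (\<phi> x)"
  using \<phi>_linear unfolding linear_on_def by blast

lemma map_zero: "\<phi> 0 = 0"
  using map_scale[OF dom.zero_mem, of 0] by simp

lemma map_component: "x \<in> G i \<Longrightarrow> \<phi> x \<in> K i"
  using \<phi>_even unfolding even_on_def by blast

lemma map_sum: "(\<And>i. i \<in> I \<Longrightarrow> f i \<in> L) \<Longrightarrow> \<phi> (sum f I) = (\<Sum>i\<in>I. \<phi> (f i))"
proof (induction I rule: infinite_finite_induct)
  case (insert i I)
  then show ?case
    using dom.subspace_sum[OF dom.subspace_carrier, of I f] by (simp add: map_add)
qed (simp_all add: map_zero)

text \<open>Membership and intertwining share one induction, because the morphism laws apply to an
  iterate only once it is known to lie in \<open>L\<close>.\<close>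

lemma map_hom_ad_pow:
  assumes "x \<in> L" "b \<in> L"
  shows "(hom_ad br \<alpha> x ^^ n) b \<in> L \<and>
    \<phi> ((hom_ad br \<alpha> x ^^ n) b) = (hom_ad br' \<beta> (\<phi> x) ^^ n) (\<phi> b)"
proof (induction n)
  case (Suc n)
  then show ?case
    using assms dom.hom_ad_mem by (auto simp: hom_ad_def \<phi>_br \<phi>_twist dom.twist_mem)
qed (use assms in simp)

lemma even_fixed_image: "x \<in> even_fixed G \<alpha> \<Longrightarrow> \<phi> x \<in> even_fixed K \<beta>"
  using dom.component_subset \<phi>_twist map_component unfolding even_fixed_def by force

text \<open>The point that needs an argument is the grading: the even and odd parts of an element of
  the preimage must lie in the preimage again. The rest follows from linearity and the morphism
  laws.\<close>

lemma preimage_subsuperalgebra: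
  assumes "hom_lie_subsuperalgebra t M K br' \<beta> C"
  shows "hom_lie_subsuperalgebra s L G br \<alpha> (preimage_on L \<phi> C)"
proof -
  interpret S: hom_lie_subsuperalgebra t M K br' \<beta> C by fact
  let ?D = "preimage_on L \<phi> C"
  note subD = dom.subspace_carrier and subC = S.sub.subspace_carrier
  have sD: "dom.subspace ?D"
    by (rule dom.subspaceI)
      (auto simp: preimage_on_def map_zero map_add map_scale
        dom.subspace_0[OF subD] dom.subspace_add[OF subD] dom.subspace_scale[OF subD]
        cod.subspace_0[OF subC] cod.subspace_add[OF subC] cod.subspace_scale[OF subC])
  show ?thesis
  proof unfold_locales
    show "dom.subspace ?D" by (fact sD)
    show "dom.subspace (?D \<inter> G i)" for i
      by (rule dom.subspace_inter[OF sD dom.subspace_component])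
    show "?D = {x + y |x y. x \<in> ?D \<inter> G 0 \<and> y \<in> ?D \<inter> G 1}"
    proof (intro equalityI subsetI)
      fix z assume z: "z \<in> ?D"
      then obtain x y where xy: "x \<in> G 0" "y \<in> G 1" "z = x + y"
        using dom.sum_components unfolding preimage_on_def by auto
      have L: "x \<in> L" "y \<in> L" using xy dom.component_subset by auto
      have "\<phi> z \<in> C" using z by (simp add: preimage_on_def)
      then have "\<phi> z \<in> {c + d |c d. c \<in> C \<inter> K 0 \<and> d \<in> C \<inter> K 1}"
        by (simp only: S.sub.sum_components[symmetric])
      then obtain c d where cd: "c \<in> C \<inter> K 0" "d \<in> C \<inter> K 1" "\<phi> z = c + d"
        by blast
      \<comment> \<open>\<open>C\<close> is graded, so \<open>c\<close> and \<open>d\<close> are the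
        parts of \<open>\<phi> z\<close> and lie in \<open>C\<close>. As \<open>\<phi>\<close> is
        even, \<open>\<phi> x\<close> and \<open>\<phi> y\<close> are parts of
        \<open>\<phi> z\<close> too, and the decomposition in \<open>M\<close> is unique.\<close>
      have "\<phi> x = c \<and> \<phi> y = d"
        by (rule cod.components_unique) (use xy cd L map_component map_add in auto)
      with xy cd L show "z \<in> {x + y |x y. x \<in> ?D \<inter> G 0 \<and> y \<in> ?D \<inter> G 1}"
        by (auto simp: preimage_on_def)
    qed (use dom.subspace_add[OF sD] in auto)
    show "?D \<inter> G 0 \<inter> (?D \<inter> G 1) = {0}"
      using dom.Int_components dom.subspace_0[OF sD] by auto
    show "?D \<subseteq> L" by (auto simp: preimage_on_def)
    show "\<alpha> ` ?D \<subseteq> ?D"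
      using S.sub_\<alpha> by (auto simp: preimage_on_def dom.twist_mem \<phi>_twist)
    show "br x y \<in> ?D" if "x \<in> ?D" "y \<in> ?D" for x y
      using that S.sub_br by (auto simp: preimage_on_def dom.br_mem \<phi>_br)
  qed
qed

end

text \<open>Makes \<open>D\<close> and \<open>C\<close> the full domain and codomain of a morphism,
  so that the transport of p-maps need only be proved for full superalgebras.\<close>

lemma hom_lie_morphism_restrict:
  assumes "multiplicative_hom_lie_superalgebra s L G br \<alpha>"
    and "multiplicative_hom_lie_superalgebra t M K br' \<beta>"
    and "hom_lie_morphism s L G br \<alpha> t M K br' \<beta> \<phi>"
    and "hom_lie_subsuperalgebra s L G br \<alpha> D"
    and "hom_lie_subsuperalgebra t M K br' \<beta> C"
    and "\<phi> ` D \<subseteq> C"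
  shows "hom_lie_morphism s D (\<lambda>j. D \<inter> G j) br (restrict \<alpha> D)
    t C (\<lambda>j. C \<inter> K j) br' (restrict \<beta> C) \<phi>"
proof -
  interpret hom_lie_morphism s L G br \<alpha> t M K br' \<beta> \<phi> by fact
  interpret D: hom_lie_subsuperalgebra s L G br \<alpha> D by fact
  interpret D': multiplicative_hom_lie_superalgebra s D "\<lambda>j. D \<inter> G j" br "restrict \<alpha> D"
    by (rule multiplicative_hom_lie_superalgebra_sub[OF assms(1,4)])
  interpret C': multiplicative_hom_lie_superalgebra t C "\<lambda>j. C \<inter> K j" br' "restrict \<beta> C"
    by (rule multiplicative_hom_lie_superalgebra_sub[OF assms(2,5)])
  show ?thesis
  proof unfold_locales
    show "linear_on s t D C \<phi>"
      by (rule linear_on_restrict[OF \<phi>_linear D.sub_subset D.sub.subspace_carrier dom.module_axioms])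
        (use assms(6) in auto)
    show "even_on (\<lambda>j. D \<inter> G j) (\<lambda>j. C \<inter> K j) \<phi>"
      using assms(6) map_component unfolding even_on_def by auto
    show "\<phi> (br u v) = br' (\<phi> u) (\<phi> v)" if "u \<in> D" "v \<in> D" for u v
      using that D.sub_subset by (auto intro: \<phi>_br)
    show "\<phi> (restrict \<alpha> D u) = restrict \<beta> C (\<phi> u)" if "u \<in> D" for u
      using that D.sub_subset assms(6) \<phi>_twist by auto
  qed
qed

section \<open>Injective morphisms: polynomial extension and pullback of p-maps\<close>

locale inj_hom_lie_morphism = hom_lie_morphism +
  assumes inj: "inj_on \<phi> L"
begin

lemma map_eq_zero_iff: "x \<in> L \<Longrightarrow> \<phi> x = 0 \<longleftrightarrow> x = 0"
  using inj_onD[OF inj, of x 0] dom.zero_mem map_zero by auto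

text \<open>The odd part of \<open>x\<close> is sent to the odd part of the even element
  \<open>\<phi> x\<close>, which is 0, so injectivity makes it vanish. Likewise
  \<open>\<alpha> x\<close> and \<open>x\<close> have the same image.\<close>

lemma even_fixed_preimage:
  assumes "x \<in> L" "\<phi> x \<in> even_fixed K \<beta>"
  shows "x \<in> even_fixed G \<alpha>"
proof -
  obtain y z where yz: "y \<in> G 0" "z \<in> G 1" "x = y + z"
    using assms(1) dom.sum_components by auto
  have L: "y \<in> L" "z \<in> L" using yz dom.component_subset by auto
  \<comment> \<open>Compares the decompositions \<open>\<phi> y + \<phi> z\<close> and
    \<open>\<phi> x + 0\<close> of \<open>\<phi> x\<close>.\<close>
  have "\<phi> y = \<phi> x \<and> \<phi> z = 0"
    by (rule cod.components_unique)
      (use yz L assms map_component map_add cod.subspace_0[OF cod.subspace_component]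
        in \<open>auto simp: even_fixed_def\<close>)
  then have "x \<in> G 0" using yz L map_eq_zero_iff by simp
  moreover have "\<alpha> x = x"
    by (rule inj_onD[OF inj]) (use assms \<phi>_twist dom.twist_mem in \<open>auto simp: even_fixed_def\<close>)
  ultimately show ?thesis by (simp add: even_fixed_def)
qed

lemma map_poly_bracket:
  assumes P: "\<And>n. coeff P n \<in> L" and Q: "\<And>n. coeff Q n \<in> L"
  shows "map_poly \<phi> (poly_bracket br P Q) = poly_bracket br' (map_poly \<phi> P) (map_poly \<phi> Q)"
proof (rule poly_eqI)
  fix n
  \<comment> \<open>Injectivity keeps the leading coefficient nonzero, so the double sums defining
    the two brackets run over the same indices.\<close>
  have deg: "degree (map_poly \<phi> R) = degree R" if "\<And>n. coeff R n \<in> L" for R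
  proof (cases "R = 0")
    case False
    then show ?thesis using that map_eq_zero_iff by (intro map_poly_degree_eq) auto
  qed simp
  have mem: "(if i + j = n then br (coeff P i) (coeff Q j) else 0) \<in> L" for i j
    using dom.br_mem[OF P Q] dom.zero_mem by simp
  have "\<phi> (coeff (poly_bracket br P Q) n) =
    (\<Sum>i\<le>degree P. \<Sum>j\<le>degree Q. \<phi> (if i + j = n then br (coeff P i) (coeff Q j) else 0))"
    unfolding poly_bracket_def
    by (simp add: coeff_sum map_sum mem dom.subspace_sum[OF dom.subspace_carrier])
  also have "\<dots> = (\<Sum>i\<le>degree P. \<Sum>j\<le>degree Q.
      if i + j = n then br' (\<phi> (coeff P i)) (\<phi> (coeff Q j)) else 0)"
    by (intro sum.cong refl) (simp add: \<phi>_br P Q map_zero)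
  also have "\<dots> = coeff (poly_bracket br' (map_poly \<phi> P) (map_poly \<phi> Q)) n"
    unfolding poly_bracket_def by (simp add: coeff_sum deg P Q coeff_map_poly map_zero)
  finally show "coeff (map_poly \<phi> (poly_bracket br P Q)) n =
    coeff (poly_bracket br' (map_poly \<phi> P) (map_poly \<phi> Q)) n"
    by (simp add: coeff_map_poly map_zero)
qed

text \<open>Polynomial analogue of \<open>map_hom_ad_pow\<close>; membership of all coefficients in
  \<open>L\<close> is again part of the induction.\<close>

lemma map_hom_ad_poly_pow:
  assumes "\<And>n. coeff P n \<in> L" "\<And>n. coeff Q n \<in> L"
  shows "(\<forall>n. coeff ((hom_ad (poly_bracket br) (map_poly \<alpha>) P ^^ m) Q) n \<in> L) \<and>
    map_poly \<phi> ((hom_ad (poly_bracket br) (map_poly \<alpha>) P ^^ m) Q) =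
      (hom_ad (poly_bracket br') (map_poly \<beta>) (map_poly \<phi> P) ^^ m) (map_poly \<phi> Q)"
proof (induction m)
  case (Suc m)
  let ?R = "(hom_ad (poly_bracket br) (map_poly \<alpha>) P ^^ m) Q"
  have mem: "coeff ?R n \<in> L" for n using Suc by blast
  have twist: "coeff (map_poly \<alpha> ?R) n \<in> L" for n
    using mem by (simp add: coeff_map_poly dom.twist_zero dom.twist_mem)
  have "map_poly \<phi> (map_poly \<alpha> ?R) = map_poly \<beta> (map_poly \<phi> ?R)"
    by (rule poly_eqI)
      (simp add: coeff_map_poly dom.twist_zero cod.twist_zero map_zero \<phi>_twist mem)
  then have "map_poly \<phi> (hom_ad (poly_bracket br) (map_poly \<alpha>) P ?R) =
      hom_ad (poly_bracket br') (map_poly \<beta>) (map_poly \<phi> P) (map_poly \<phi> ?R)"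
    by (simp add: hom_ad_def[of _ _ _ ?R] hom_ad_def[of _ _ _ "map_poly \<phi> ?R"]
        map_poly_bracket[OF assms(1) twist])
  moreover have "coeff (hom_ad (poly_bracket br) (map_poly \<alpha>) P ?R) n \<in> L" for n
    by (subst hom_ad_def) (rule dom.coeff_poly_bracket_mem[OF assms(1) twist])
  ultimately show ?case using Suc by simp
qed (use assms in simp)

text \<open>Applying \<open>\<phi>\<close> coefficientwise turns \<open>[:y, x:]\<close> into
  \<open>[:\<phi> y, \<phi> x:]\<close>, intertwines the operator powers, and commutes with taking a
  coefficient and with scaling by the inverse of i.\<close>

lemma s_term_mem_map:
  assumes "x \<in> L" "y \<in> L"
  shows "s_term s br \<alpha> i x y \<in> L"
    and "\<phi> (s_term s br \<alpha> i x y) = s_term t br' \<beta> i (\<phi> x) (\<phi> y)"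
proof -
  let ?R = "(hom_ad (poly_bracket br) (map_poly \<alpha>) [:y, x:] ^^ (CHAR('a) - 1)) [:x:]"
  have coeffs: "coeff [:y, x:] n \<in> L" "coeff [:x:] n \<in> L" for n
    using assms dom.zero_mem by (auto simp: coeff_pCons split: nat.split)
  have map: "map_poly \<phi> [:y, x:] = [:\<phi> y, \<phi> x:]" "map_poly \<phi> [:x:] = [:\<phi> x:]"
    by (simp_all add: map_poly_pCons map_zero)
  note R = map_hom_ad_poly_pow[OF coeffs, of "CHAR('a) - 1", unfolded map]
  show "s_term s br \<alpha> i x y \<in> L"
    unfolding s_term_def using R by (intro dom.subspace_scale[OF dom.subspace_carrier]) blast
  have "\<phi> (coeff ?R (i - 1)) = coeff (map_poly \<phi> ?R) (i - 1)"
    by (simp add: coeff_map_poly map_zero)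
  then show "\<phi> (s_term s br \<alpha> i x y) = s_term t br' \<beta> i (\<phi> x) (\<phi> y)"
    unfolding s_term_def using R by (simp add: map_scale)
qed

text \<open>Stated for any \<open>pm'\<close> lifting \<open>pm\<close> along \<open>\<phi>\<close>,
  so that the choice of inverse stays out of the argument. Each p-map identity equates two elements
  of \<open>L\<close> with equal images.\<close>

lemma p_map_pullback:
  assumes pm: "p_map t M K br' \<beta> pm"
    and mem: "\<And>x. x \<in> even_fixed G \<alpha> \<Longrightarrow> pm' x \<in> L"
    and lift: "\<And>x. x \<in> even_fixed G \<alpha> \<Longrightarrow> \<phi> (pm' x) = pm (\<phi> x)"
  shows "p_map s L G br \<alpha> pm'"
proof -
  let ?E = "even_fixed G \<alpha>"
  have E: "x \<in> L" "\<phi> x \<in> even_fixed K \<beta>" if "x \<in> ?E" for x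
    using that dom.component_subset even_fixed_image by (auto simp: even_fixed_def)
  \<comment> \<open>\<open>lift\<close> is available only on \<open>?E\<close>, so closure of
    \<open>?E\<close> is needed to use it at \<open>s k x\<close> and at
    \<open>x + y\<close>.\<close>
  have E_scale: "s k x \<in> ?E" if x: "x \<in> ?E" for k x
    using x E(1)[OF x] dom.\<alpha>_linear dom.subspace_scale[OF dom.subspace_component]
    by (auto simp: even_fixed_def linear_on_def)
  have E_add: "x + y \<in> ?E" if "x \<in> ?E" "y \<in> ?E" for x y
    using that E(1)[OF that(1)] E(1)[OF that(2)] dom.\<alpha>_linear
      dom.subspace_add[OF dom.subspace_component]
    by (auto simp: even_fixed_def linear_on_def)
  note addL = dom.subspace_add[OF dom.subspace_carrier]
    and scaleL = dom.subspace_scale[OF dom.subspace_carrier]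
  show ?thesis
    unfolding p_map_def
  proof (intro conjI ballI allI funcsetI)
    fix x assume x: "x \<in> ?E"
    \<comment> \<open>\<open>pm (\<phi> x)\<close> is even and fixed by \<open>\<beta>\<close>, and
      these properties lift to its preimage \<open>pm' x\<close>.\<close>
    show "pm' x \<in> ?E"
      by (rule even_fixed_preimage) (use x E mem lift pm in \<open>auto simp: p_map_def\<close>)
    show "(hom_ad br \<alpha> x ^^ CHAR('a)) b = hom_ad br \<alpha> (pm' x) b" if b: "b \<in> L" for b
    proof (rule inj_onD[OF inj])
      have "\<phi> ((hom_ad br \<alpha> x ^^ CHAR('a)) b) = hom_ad br' \<beta> (pm (\<phi> x)) (\<phi> b)"
        using map_hom_ad_pow[OF E(1)[OF x] b] pm E(2)[OF x] map_mem[OF b]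
        by (simp add: p_map_def)
      \<comment> \<open>Exponent 1 gives the intertwining of a single operator.\<close>
      also have "\<dots> = \<phi> (hom_ad br \<alpha> (pm' x) b)"
        using map_hom_ad_pow[OF mem[OF x] b, of 1] lift[OF x] by simp
      finally show "\<phi> ((hom_ad br \<alpha> x ^^ CHAR('a)) b) = \<phi> (hom_ad br \<alpha> (pm' x) b)" .
    qed (use map_hom_ad_pow[OF E(1)[OF x] b] dom.hom_ad_mem[OF mem[OF x] b] in auto)
    show "pm' (s k x) = s (k ^ CHAR('a)) (pm' x)" for k
    proof (rule inj_onD[OF inj])
      show "\<phi> (pm' (s k x)) = \<phi> (s (k ^ CHAR('a)) (pm' x))"
        using pm E[OF x] lift[OF x] lift[OF E_scale[OF x]] mem[OF x]
        by (simp add: p_map_def map_scale)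
    qed (use mem x E_scale scaleL in auto)
    fix y assume y: "y \<in> ?E"
    let ?s = "\<lambda>i. s_term s br \<alpha> i x y"
    have s: "?s i \<in> L" "\<phi> (?s i) = s_term t br' \<beta> i (\<phi> x) (\<phi> y)" for i
      using s_term_mem_map E(1) x y by auto
    have sum: "sum ?s {1..CHAR('a) - 1} \<in> L"
      by (rule dom.subspace_sum[OF dom.subspace_carrier]) (rule s)
    show "pm' (x + y) = pm' x + pm' y + sum ?s {1..CHAR('a) - 1}"
    proof (rule inj_onD[OF inj])
      have "\<phi> (pm' (x + y)) = pm (\<phi> x + \<phi> y)"
        using lift[OF E_add[OF x y]] map_add E x y by simp
      also have "\<dots> = pm (\<phi> x) + pm (\<phi> y)
          + (\<Sum>i = 1..CHAR('a) - 1. s_term t br' \<beta> i (\<phi> x) (\<phi> y))"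
        using pm E x y unfolding p_map_def by blast
      also have "\<dots> = \<phi> (pm' x + pm' y + sum ?s {1..CHAR('a) - 1})"
        using lift[OF x] lift[OF y] mem[OF x] mem[OF y] s sum
        by (simp add: map_add map_sum addL)
      finally show "\<phi> (pm' (x + y)) = \<phi> (pm' x + pm' y + sum ?s {1..CHAR('a) - 1})" .
    qed (use mem x y E_add addL sum in auto)
  qed
qed

end

theorem theorem7:
  fixes scaleL :: "'f::field \<Rightarrow> 'v::ab_group_add \<Rightarrow> 'v"
    and scaleM :: "'f \<Rightarrow> 'w::ab_group_add \<Rightarrow> 'w"
    and L :: "'v set" and GL :: "bit \<Rightarrow> 'v set"
    and brL :: "'v \<Rightarrow> 'v \<Rightarrow> 'v" and \<alpha> :: "'v \<Rightarrow> 'v"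
    and M :: "'w set" and GM :: "bit \<Rightarrow> 'w set"
    and brM :: "'w \<Rightarrow> 'w \<Rightarrow> 'w" and \<beta> :: "'w \<Rightarrow> 'w"
    and \<phi> :: "'v \<Rightarrow> 'w" and C :: "'w set" and pm :: "'w \<Rightarrow> 'w"
  defines "D \<equiv> preimage_on L \<phi> C"
  assumes "CHAR('f) > 0" and "CHAR('f) \<noteq> 2" and "CHAR('f) \<noteq> 3"
    and "multiplicative_hom_lie_superalgebra scaleL L GL brL \<alpha>"
    and "multiplicative_hom_lie_superalgebra scaleM M GM brM \<beta>"
    and "hom_lie_morphism scaleL L GL brL \<alpha> scaleM M GM brM \<beta> \<phi>"
    and "inj_on \<phi> L"
    and "hom_lie_subsuperalgebra scaleM M GM brM \<beta> C"
    and "p_map scaleM C (\<lambda>j. C \<inter> GM j) brM (restrict \<beta> C) pm"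
    \<comment> \<open>the inverse image used to define the p-map of the conclusion exists\<close>
    and "\<And>x. x \<in> even_fixed (\<lambda>j. D \<inter> GL j) (restrict \<alpha> D) \<Longrightarrow> pm (\<phi> x) \<in> \<phi> ` L"
  shows "restricted_hom_lie_superalgebra scaleL D (\<lambda>j. D \<inter> GL j) brL (restrict \<alpha> D)
    (\<lambda>x. inv_into L \<phi> (pm (\<phi> x)))"
proof -
  interpret hom_lie_morphism scaleL L GL brL \<alpha> scaleM M GM brM \<beta> \<phi> by fact
  have D_mem: "x \<in> D \<longleftrightarrow> x \<in> L \<and> \<phi> x \<in> C" for x
    by (simp add: D_def preimage_on_def)
  have subD: "hom_lie_subsuperalgebra scaleL L GL brL \<alpha> D"
    unfolding D_def by (rule preimage_subsuperalgebra) fact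
  let ?GD = "\<lambda>j. D \<inter> GL j" and ?\<alpha> = "restrict \<alpha> D" and ?pm' = "\<lambda>x. inv_into L \<phi> (pm (\<phi> x))"
  interpret R: hom_lie_morphism scaleL D ?GD brL ?\<alpha>
    scaleM C "\<lambda>j. C \<inter> GM j" brM "restrict \<beta> C" \<phi>
    by (rule hom_lie_morphism_restrict[OF assms(5,6,7) subD assms(9)]) (auto simp: D_mem)
  \<comment> \<open>Injectivity passes from \<open>L\<close> to its subset \<open>D\<close>.\<close>
  interpret R: inj_hom_lie_morphism scaleL D ?GD brL ?\<alpha>
    scaleM C "\<lambda>j. C \<inter> GM j" brM "restrict \<beta> C" \<phi>
    by unfold_locales (rule inj_on_subset[OF assms(8)], auto simp: D_mem)
  have lift: "\<phi> (?pm' x) = pm (\<phi> x)" "?pm' x \<in> D" if x: "x \<in> even_fixed ?GD ?\<alpha>" for x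
  proof -
    \<comment> \<open>\<open>inv_into\<close> is a true inverse here because
      \<open>pm (\<phi> x)\<close> lies in the image of \<open>L\<close>.\<close>
    show eq: "\<phi> (?pm' x) = pm (\<phi> x)"
      by (rule f_inv_into_f[OF assms(11)[OF x]])
    \<comment> \<open>\<open>inv_into\<close> only yields a point of \<open>L\<close>; that point
      lies in \<open>D\<close> because its image lies in \<open>C\<close>.\<close>
    have "pm (\<phi> x) \<in> C"
      using assms(10) R.even_fixed_image[OF x] by (auto simp: p_map_def even_fixed_def)
    then show "?pm' x \<in> D"
      using eq inv_into_into[OF assms(11)[OF x]] by (simp add: D_mem)
  qed
  have "p_map scaleL D ?GD brL ?\<alpha> ?pm'"
    by (rule R.p_map_pullback[OF assms(10)]) (use lift in auto)
  then show ?thesis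
    using multiplicative_hom_lie_superalgebra_sub[OF assms(5) subD]
    by (simp add: restricted_hom_lie_superalgebra_def restricted_hom_lie_superalgebra_axioms_def)
qed

end
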